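(* For $\epsilon>0$, $N\in\mathbb{N}_+$ and a positive integer $\tau$ consider the evaluation and Jacobian oracle-complexity upper bounds $$E(\epsilon,N,\tau)=\widetilde{\Theta} \left( N+ \epsilon^{-1} \tau^3 + N\epsilon^{-1} \tau^{-1} + \epsilon^{-2} \tau^2 \right),\qquad J(\epsilon,N,\tau)=\widetilde{\Theta} \left( N+\tau^3+ N\epsilon^{-1} \tau^{-1} + \epsilon^{-1} \tau^2 \right).$$ (i) The minimal asymptotic rate of $E$ with respect to the choice of $\tau$ (as a function of $\epsilon,N$) is $\widetilde{\Theta} \left( N+ \epsilon^{-2}+ N^{2/3} \epsilon^{-4/3} \right)$, achieved by setting $\tau = \Theta \left( \max\{ 1, N^{1/3} \epsilon^{1/3} \} \right)$. In this case, $J$ becomes $\widetilde{\Theta} \left( \min \{ N\epsilon^{-1}, N+ N^{2/3} \epsilon^{-4/3} \} \right)$. (ii) The minimal asymptotic rate of $J$ with respect to the choice of $\tau$ is $\widetilde{\Theta} \left( N + N^{2/3} \epsilon^{-1} \right)$, achieved by setting $\tau = \Theta \left( N^{1/3} \right)$. In this case, $E$ becomes $\widetilde{\Theta} \left( N\epsilon^{-1} + N^{2/3} \epsilon^{-2} \right)$.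
   Context: Asymptotic notation is with respect to $\epsilon\to0$ and $N\to\infty$, and $\widetilde\Theta$ omits multiplicative logarithmic terms in $\epsilon$. Meaning of the quantities: for minimizing $f(g(x))+h(x)$ with $g=\frac1N\sum_{j=1}^N g_j$ by the variance-reduced inexact prox-linear method whose inner loops all have length $\tau$, $E$ and $J$ are upper bounds on the number of evaluations of $g_j$ and of Jacobians $g'_j$ used to make the average of $\|\mathcal{G}_M\|_2^2$ over the iterates at most $\epsilon$ with high probability, when $g$ and $g'$ are computed exactly at the start $x_0$ of each inner loop and, at the $i$-th inner iterate $x_i$, $i>0$, are estimated by $\widetilde g_i=\frac1a\sum_{j\in\mathcal{A}_i}(g_j(x_i)-g_j(x_0))+g(x_0)$, $\widetilde J_i=\frac1b\sum_{j\in\mathcal{B}_i}(g'_j(x_i)-g'_j(x_0))+g'(x_0)$ with batches $\mathcal{A}_i,\mathcal{B}_i$ of sizes $a,b$ sampled uniformly with replacement from $\{1,\dots,N\}$. The claim concerns only the two displayed expressions. *)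

theory Defs
  imports Complex_Main "HOL-Library.Landau_Symbols"
begin

text \<open>
  Soft Landau classes for functions of a tuple whose first component is \<open>\<epsilon>\<close>: constant factors and
  arbitrary powers of \<open>ln (1 / \<epsilon>)\<close> are ignored, while logarithms of the other components are not.
  The exponents of the upper and the lower bound need not agree.
\<close>

definition soft_bigo ::
  "(real \<times> 'a) filter \<Rightarrow> (real \<times> 'a \<Rightarrow> real) \<Rightarrow> (real \<times> 'a \<Rightarrow> real) set"
  where "soft_bigo F g = {f. \<exists>k::nat. f \<in> O[F](\<lambda>x. g x * ln (1 / fst x) ^ k)}"

definition soft_bigtheta ::
  "(real \<times> 'a) filter \<Rightarrow> (real \<times> 'a \<Rightarrow> real) \<Rightarrow> (real \<times> 'a \<Rightarrow> real) set"
  where "soft_bigtheta F g = {f. f \<in> soft_bigo F g \<and> g \<in> soft_bigo F f}"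

text \<open>The joint limit \<open>\<epsilon> \<rightarrow> 0\<close> (from the right) and \<open>N \<rightarrow> \<infinity>\<close>, independently of each other.\<close>

definition eps_N :: "(real \<times> nat) filter"
  where "eps_N = at_right 0 \<times>\<^sub>F at_top"

text \<open>
  The same limit for functions of \<open>(\<epsilon>, N, \<tau>)\<close>.  There is no limit in \<open>\<tau>\<close>: the principal filter makes
  the hidden constants and the threshold for \<open>\<epsilon>\<close> and \<open>N\<close> uniform in the positive integer \<open>\<tau>\<close>.
\<close>

definition eps_N_tau :: "(real \<times> nat \<times> nat) filter"
  where "eps_N_tau = at_right 0 \<times>\<^sub>F (at_top \<times>\<^sub>F principal {1..})"

definition tau_choice :: "(real \<Rightarrow> nat \<Rightarrow> nat) \<Rightarrow> bool"
  where "tau_choice \<tau> \<longleftrightarrow> (\<forall>\<epsilon>>0. \<forall>N\<ge>1. \<tau> \<epsilon> N \<ge> 1)"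

definition rate_at ::
  "(real \<Rightarrow> nat \<Rightarrow> nat \<Rightarrow> real) \<Rightarrow> (real \<Rightarrow> nat \<Rightarrow> nat) \<Rightarrow> real \<times> nat \<Rightarrow> real"
  where "rate_at C \<tau> = (\<lambda>(\<epsilon>, N). C \<epsilon> N (\<tau> \<epsilon> N))"

text \<open>No choice of \<open>\<tau>\<close> gives a smaller rate than \<open>R\<close>, and some choice gives the rate \<open>R\<close>.\<close>

definition minimal_rate ::
  "(real \<Rightarrow> nat \<Rightarrow> nat \<Rightarrow> real) \<Rightarrow> (real \<times> nat \<Rightarrow> real) \<Rightarrow> bool"
  where "minimal_rate C R \<longleftrightarrow>
    (\<forall>\<tau>. tau_choice \<tau> \<longrightarrow> R \<in> soft_bigo eps_N (rate_at C \<tau>)) \<and>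
    (\<exists>\<tau>. tau_choice \<tau> \<and> rate_at C \<tau> \<in> soft_bigtheta eps_N R)"

definition tau_of_order :: "(real \<times> nat \<Rightarrow> real) \<Rightarrow> (real \<Rightarrow> nat \<Rightarrow> nat) set"
  where "tau_of_order s =
    {\<tau>. tau_choice \<tau> \<and> (\<lambda>(\<epsilon>, N). real (\<tau> \<epsilon> N)) \<in> \<Theta>[eps_N](s)}"

end

theory Submission
  imports Defs
begin

text \<open>
  Write \<open>N = x\<^sup>3\<close> and \<open>\<epsilon> = 1 / u\<^sup>3\<close>, which turns all rates into Laurent monomials in \<open>x\<close>, \<open>u\<close> and
  \<open>\<tau>\<close>. The lower bounds come from balancing the decreasing term \<open>N / (\<epsilon> \<tau>)\<close> against the increasing
  quadratic term: whichever side of the balance point \<open>\<tau>\<close> lies on, one of the two is at least their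
  common value there. The stated choices of \<open>\<tau>\<close> are these balance points, cut off
  at the least admissible value \<open>1\<close>, which accounts for the term \<open>\<epsilon>\<^sup>-\<^sup>2\<close>. Since each cost is
  a sum of monomials in \<open>\<tau>\<close>, changing \<open>\<tau>\<close> by a constant factor changes it by at most the
  cube of that factor.
\<close>

section \<open>Elementary estimates for the cost as a function of a real parameter\<close>

text \<open>One shape for both complexities: \<open>a\<close> is N and \<open>b\<close> is N /
  \<epsilon> in both, while the pair \<open>p\<close>, \<open>q\<close> is 1 / \<epsilon>, 1 /
  \<epsilon>^2 for \<open>E\<close> and 1, 1 / \<epsilon> for \<open>J\<close>. The argument is
  real, so that the cost can be evaluated at balance points that are not integers.\<close>

definition cost :: "real \<Rightarrow> real \<Rightarrow> real \<Rightarrow> real \<Rightarrow> real \<Rightarrow> real"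
  where "cost a p b q t = a + p * t ^ 3 + b / t + q * t ^ 2"

text \<open>Termwise: the increasing terms use \<open>t \<le> K * s\<close>, the decreasing one
  \<open>s \<le> K * t\<close>. The four terms lose the factors 1, K^3, K and K^2, all absorbed by
  K^3 since \<open>1 \<le> K\<close>.\<close>

lemma cost_rescale:
  assumes nn: "0 \<le> a" "0 \<le> p" "0 \<le> b" "0 \<le> q"
    and "0 < s" "0 < t" and K: "1 \<le> K" and ts: "t \<le> K * s" and st: "s \<le> K * t"
  shows "cost a p b q t \<le> K ^ 3 * cost a p b q s"
proof -
  have K13: "K \<le> K ^ 3" and K23: "K ^ 2 \<le> K ^ 3" and K03: "1 \<le> K ^ 3"
    using K by (auto intro: self_le_power power_increasing one_le_power)
  have "a \<le> K ^ 3 * a"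
    using mult_right_mono[OF K03 nn(1)] by simp
  moreover have "p * t ^ 3 \<le> K ^ 3 * (p * s ^ 3)"
    using mult_left_mono[OF power_mono[OF ts, of 3] nn(2)] \<open>0 < t\<close>
    by (simp add: power_mult_distrib mult_ac)
  moreover have "b / t \<le> K ^ 3 * (b / s)"
  proof -
    have "1 / t \<le> K / s"
      using st assms(5,6) by (simp add: field_simps)
    then have "b / t \<le> K * (b / s)"
      using mult_left_mono[OF _ nn(3), of "1 / t" "K / s"] by (simp add: mult_ac)
    also have "\<dots> \<le> K ^ 3 * (b / s)"
      by (rule mult_right_mono[OF K13]) (use nn assms(5) in simp)
    finally show ?thesis .
  qed
  moreover have "q * t ^ 2 \<le> K ^ 3 * (q * s ^ 2)"
  proof -
    have "q * t ^ 2 \<le> K ^ 2 * (q * s ^ 2)"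
      using mult_left_mono[OF power_mono[OF ts, of 2] nn(4)] \<open>0 < t\<close>
      by (simp add: power_mult_distrib mult_ac)
    also have "\<dots> \<le> K ^ 3 * (q * s ^ 2)"
      by (rule mult_right_mono[OF K23]) (use nn in simp)
    finally show ?thesis .
  qed
  ultimately show ?thesis
    unfolding cost_def distrib_left by linarith
qed

lemma cost_nonneg:
  assumes "0 \<le> a" "0 \<le> p" "0 \<le> b" "0 \<le> q" "0 \<le> t"
  shows "0 \<le> cost a p b q t"
  using assms by (simp add: cost_def)

text \<open>Later applied at the point \<open>s\<close> where \<open>b / s\<close> and
  \<open>q * s ^ 2\<close> agree, so that the minimum is their common value.\<close>

lemma balance_le:
  fixes b q s t :: real
  assumes "0 \<le> b" "0 \<le> q" "0 < s" "0 < t"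
  shows "min (b / s) (q * s ^ 2) \<le> b / t + q * t ^ 2"
proof (cases "t \<le> s")
  case True
  then have "b / s \<le> b / t"
    using assms by (simp add: divide_left_mono)
  moreover have "0 \<le> q * t ^ 2"
    using assms by simp
  ultimately show ?thesis by linarith
next
  case False
  then have "q * s ^ 2 \<le> q * t ^ 2"
    using assms by (intro mult_left_mono power_mono) auto
  moreover have "0 \<le> b / t"
    using assms by simp
  ultimately show ?thesis by linarith
qed

section \<open>Pointwise bounds in the cube-root variables\<close>

lemma cube_root_substitution:
  fixes \<epsilon> :: real and N :: nat
  assumes "0 < \<epsilon>" "\<epsilon> < 1" "1 \<le> N"
  obtains x u :: real where "1 \<le> x" "1 \<le> u" "real N = x ^ 3" "\<epsilon> = 1 / u ^ 3"
    "real N powr (1/3) = x" "\<epsilon> powr (1/3) = 1 / u"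
    "real N powr (2/3) = x ^ 2" "\<epsilon> powr (-4/3) = u ^ 4"
proof
  let ?x = "real N powr (1/3)" and ?u = "\<epsilon> powr (-1/3)"
  show "1 \<le> ?x"
    using assms by (simp add: ge_one_powr_ge_zero)
  show "1 \<le> ?u"
    using powr_mono2'[of "-1/3" \<epsilon> 1] assms by auto
  show "real N = ?x ^ 3" "real N powr (2/3) = ?x ^ 2" "\<epsilon> powr (-4/3) = ?u ^ 4"
    using assms by (simp_all add: powr_power)
  show "\<epsilon> = 1 / ?u ^ 3" "\<epsilon> powr (1/3) = 1 / ?u"
    using assms by (simp_all add: powr_power powr_minus field_simps)
qed simp

text \<open>The terms \<open>x ^ 3 * u ^ 3 / t\<close> and \<open>u ^ 6 * t ^ 2\<close> balance at t
  = x / u with common value \<open>x ^ 2 * u ^ 4\<close>, which is N^(2/3) \<epsilon>^(-4/3). The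
  quadratic term also dominates \<epsilon>^(-2) because \<open>1 \<le> t\<close>; being used twice,
  it causes the factor 2.\<close>

lemma eval_rate_le_cost:
  assumes "0 < \<epsilon>" "\<epsilon> < 1" "1 \<le> N" "1 \<le> t"
  shows "real N + 1 / \<epsilon> ^ 2 + real N powr (2/3) * \<epsilon> powr (-4/3)
    \<le> 2 * cost N (1 / \<epsilon>) (N / \<epsilon>) (1 / \<epsilon> ^ 2) t"
proof -
  obtain x u where xu: "1 \<le> x" "1 \<le> u" "real N = x ^ 3" "\<epsilon> = 1 / u ^ 3"
    "real N powr (2/3) = x ^ 2" "\<epsilon> powr (-4/3) = u ^ 4"
    using cube_root_substitution assms(1-3) by metis
  have bal: "x ^ 3 * u ^ 3 / (x / u) = x ^ 2 * u ^ 4" "u ^ 6 * (x / u) ^ 2 = x ^ 2 * u ^ 4"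
    using xu(1,2) by (simp_all add: field_simps flip: power_add) (simp_all add: eval_nat_numeral)
  have "x ^ 2 * u ^ 4 \<le> x ^ 3 * u ^ 3 / t + u ^ 6 * t ^ 2"
    using balance_le[of "x ^ 3 * u ^ 3" "u ^ 6" "x / u" t] xu(1,2) assms(4)
    unfolding bal by simp
  moreover have "u ^ 6 \<le> u ^ 6 * t ^ 2"
    using assms(4) xu(2) mult_left_mono[of 1 "t ^ 2" "u ^ 6"] by simp
  moreover have "0 \<le> u ^ 3 * t ^ 3" "0 \<le> x ^ 3" "0 \<le> x ^ 3 * u ^ 3 / t"
    using xu(1,2) assms(4) by simp_all
  ultimately have "x ^ 3 + u ^ 6 + x ^ 2 * u ^ 4
      \<le> 2 * (x ^ 3 + u ^ 3 * t ^ 3 + x ^ 3 * u ^ 3 / t + u ^ 6 * t ^ 2)"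
    unfolding distrib_left by linarith
  then show ?thesis
    unfolding xu(5,6) by (simp add: cost_def xu(3,4) power_divide flip: power_mult)
qed

text \<open>Here the quadratic term is \<open>u ^ 3 * t ^ 2\<close>, so the balance point is x =
  N^(1/3), independent of \<epsilon>, with common value \<open>x ^ 2 * u ^ 3\<close>. Each term is
  used only once, hence no constant factor.\<close>

lemma jacobian_rate_le_cost:
  assumes "0 < \<epsilon>" "\<epsilon> < 1" "1 \<le> N" "1 \<le> t"
  shows "real N + real N powr (2/3) / \<epsilon> \<le> cost N 1 (N / \<epsilon>) (1 / \<epsilon>) t"
proof -
  obtain x u where xu: "1 \<le> x" "1 \<le> u" "real N = x ^ 3" "\<epsilon> = 1 / u ^ 3"
    "real N powr (2/3) = x ^ 2"
    using cube_root_substitution assms(1-3) by metis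
  have bal: "x ^ 3 * u ^ 3 / x = x ^ 2 * u ^ 3" "u ^ 3 * x ^ 2 = x ^ 2 * u ^ 3"
    using xu(1) by (simp_all add: eval_nat_numeral)
  have "x ^ 2 * u ^ 3 \<le> x ^ 3 * u ^ 3 / t + u ^ 3 * t ^ 2"
    using balance_le[of "x ^ 3 * u ^ 3" "u ^ 3" x t] xu(1,2) assms(4)
    unfolding bal by simp
  moreover have "0 \<le> t ^ 3"
    using assms(4) by simp
  ultimately have "x ^ 3 + x ^ 2 * u ^ 3 \<le> x ^ 3 + t ^ 3 + x ^ 3 * u ^ 3 / t + u ^ 3 * t ^ 2"
    by linarith
  then show ?thesis
    unfolding xu(5) by (simp add: cost_def xu(3,4))
qed

lemma cost_at_eval_choice:
  assumes "0 < \<epsilon>" "\<epsilon> < 1" "1 \<le> N"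
  defines "s \<equiv> max 1 (real N powr (1/3) * \<epsilon> powr (1/3))"
    and "R \<equiv> min (real N / \<epsilon>) (real N + real N powr (2/3) * \<epsilon> powr (-4/3))"
  shows "cost N (1 / \<epsilon>) (N / \<epsilon>) (1 / \<epsilon> ^ 2) s
      \<le> 4 * (real N + 1 / \<epsilon> ^ 2 + real N powr (2/3) * \<epsilon> powr (-4/3))" (is ?E)
    and "cost N 1 (N / \<epsilon>) (1 / \<epsilon>) s \<le> 4 * R" (is ?J)
    and "R \<le> cost N 1 (N / \<epsilon>) (1 / \<epsilon>) s" (is ?J')
proof -
  obtain x u where xu: "1 \<le> x" "1 \<le> u" "real N = x ^ 3" "\<epsilon> = 1 / u ^ 3"
    "real N powr (1/3) = x" "\<epsilon> powr (1/3) = 1 / u"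
    "real N powr (2/3) = x ^ 2" "\<epsilon> powr (-4/3) = u ^ 4"
    using cube_root_substitution[OF assms(1-3)] by metis
  have s: "s = max 1 (x / u)"
    by (simp add: s_def xu(5,6))
  have R: "R = min (x ^ 3 * u ^ 3) (x ^ 3 + x ^ 2 * u ^ 4)"
    unfolding R_def xu(7,8) by (simp add: xu(3,4))
  \<comment> \<open>Replaces an upper bound by the minimum \<open>R\<close> with two bounds that are
    linear in the monomials, as \<open>linarith\<close> requires.\<close>
  have R_ge: "c \<le> 4 * R"
    if "c \<le> 4 * (x ^ 3 * u ^ 3)" "c \<le> 4 * x ^ 3 + 4 * (x ^ 2 * u ^ 4)" for c
    using that unfolding R by (simp add: min_def)
  have R_le: "R \<le> x ^ 3 * u ^ 3" "R \<le> x ^ 3 + x ^ 2 * u ^ 4"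
    by (simp_all add: R)
  have E: "?E \<longleftrightarrow> x ^ 3 + u ^ 3 * s ^ 3 + x ^ 3 * u ^ 3 / s + u ^ 6 * s ^ 2
      \<le> 4 * x ^ 3 + 4 * u ^ 6 + 4 * (x ^ 2 * u ^ 4)"
    unfolding xu(7,8) by (simp add: cost_def xu(3,4) power_divide flip: power_mult)
  have J: "cost N 1 (N / \<epsilon>) (1 / \<epsilon>) s = x ^ 3 + s ^ 3 + x ^ 3 * u ^ 3 / s + u ^ 3 * s ^ 2"
    by (simp add: cost_def xu(3,4))
  have pos: "0 < x" "0 < u"
    using xu(1,2) by simp_all
  have "?E \<and> ?J \<and> ?J'"
  proof (cases "u \<le> x")
    \<comment> \<open>This is the regime N \<epsilon> \<ge> 1, where the balance point x / u is
      admissible. There \<open>x ^ 2 * u ^ 4\<close> is at most \<open>x ^ 3 * u ^ 3\<close>, so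
      \<open>R\<close> is the second argument of the minimum up to a factor 2.\<close>
    case True
    then have s': "s = x / u"
      using pos by (simp add: s field_simps)
    have terms: "u ^ 3 * s ^ 3 = x ^ 3" "x ^ 3 * u ^ 3 / s = x ^ 2 * u ^ 4"
      "u ^ 6 * s ^ 2 = x ^ 2 * u ^ 4" "u ^ 3 * s ^ 2 = x ^ 2 * u"
      using pos unfolding s' by (simp_all add: field_simps eval_nat_numeral)
    have "u * (x ^ 2 * u ^ 3) \<le> x * (x ^ 2 * u ^ 3)"
      using True pos by (intro mult_right_mono) auto
    then have a: "x ^ 2 * u ^ 4 \<le> x ^ 3 * u ^ 3"
      by (simp add: eval_nat_numeral mult_ac)
    have b: "x ^ 3 \<le> x ^ 3 * u ^ 3"
      using xu(2) pos mult_left_mono[of 1 "u ^ 3" "x ^ 3"] by simp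
    have c: "s ^ 3 \<le> x ^ 3"
      using xu(1,2) by (intro power_mono) (auto simp: s' field_simps)
    have d: "x ^ 2 * u \<le> x ^ 2 * u ^ 4"
      using xu(2) by (intro mult_left_mono self_le_power) auto
    have e: "0 \<le> x ^ 3" "0 \<le> x ^ 2 * u ^ 4" "0 \<le> u ^ 6" "0 \<le> s ^ 3" "0 \<le> x ^ 2 * u"
      using pos by (simp_all add: s')
    show ?thesis
      unfolding E J terms using R_le a b c d e by (intro conjI R_ge; linarith)
  next
    \<comment> \<open>This is the regime N \<epsilon> < 1, where the cutoff gives s = 1. Now
      \<open>x ^ 3 * u ^ 3\<close> is the smaller argument of the minimum and dominates every term
      of the Jacobian cost, while \<open>u ^ 6\<close> dominates the last three terms of the
      evaluation cost.\<close>
    case False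
    then have s': "s = 1"
      using pos by (simp add: s)
    have "x * (x ^ 2 * u ^ 3) \<le> u * (x ^ 2 * u ^ 3)"
      using False pos by (intro mult_right_mono) auto
    then have a: "x ^ 3 * u ^ 3 \<le> x ^ 2 * u ^ 4"
      by (simp add: eval_nat_numeral mult_ac)
    have b: "u ^ 3 \<le> u ^ 6"
      using xu(2) by (intro power_increasing) auto
    have "x ^ 3 * u ^ 3 \<le> u ^ 3 * u ^ 3"
      using False pos by (intro mult_right_mono power_mono) auto
    then have c: "x ^ 3 * u ^ 3 \<le> u ^ 6"
      by (simp flip: power_add)
    have d: "x ^ 3 \<le> x ^ 3 * u ^ 3" "u ^ 3 \<le> x ^ 3 * u ^ 3" "1 \<le> x ^ 3"
      using xu(1,2) mult_left_mono[of 1 "u ^ 3" "x ^ 3"] mult_right_mono[of 1 "x ^ 3" "u ^ 3"]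
      by simp_all
    have e: "0 \<le> x ^ 3" "0 \<le> x ^ 2 * u ^ 4" "0 \<le> u ^ 6" "0 \<le> u ^ 3"
      using pos by simp_all
    show ?thesis
      unfolding E J unfolding s' power_one div_by_1 mult_1_right
      using R_le a b c d e by (intro conjI R_ge; linarith)
  qed
  then show ?E ?J ?J' by blast+
qed

text \<open>The balance point x is at least 1 already, so no cutoff occurs. The Jacobian cost there
  is exactly twice its rate. In the evaluation cost the cubic and quadratic terms sum to
  \<open>R\<close>, and the other two are dominated by them since u \<ge> 1.\<close>

lemma cost_at_jacobian_choice:
  assumes "0 < \<epsilon>" "\<epsilon> < 1" "1 \<le> N"
  defines "s \<equiv> real N powr (1/3)"
    and "R \<equiv> real N / \<epsilon> + real N powr (2/3) / \<epsilon> ^ 2"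
  shows "cost N 1 (N / \<epsilon>) (1 / \<epsilon>) s \<le> 2 * (real N + real N powr (2/3) / \<epsilon>)"
    and "cost N (1 / \<epsilon>) (N / \<epsilon>) (1 / \<epsilon> ^ 2) s \<le> 3 * R"
    and "R \<le> cost N (1 / \<epsilon>) (N / \<epsilon>) (1 / \<epsilon> ^ 2) s"
proof -
  obtain x u where xu: "1 \<le> x" "1 \<le> u" "real N = x ^ 3" "\<epsilon> = 1 / u ^ 3"
    "real N powr (1/3) = x" "real N powr (2/3) = x ^ 2"
    using cube_root_substitution[OF assms(1-3)] by metis
  have bal: "x ^ 3 * u ^ 3 / x = x ^ 2 * u ^ 3"
    using xu(1) by (simp add: eval_nat_numeral)
  have E: "cost N (1 / \<epsilon>) (N / \<epsilon>) (1 / \<epsilon> ^ 2) s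
      = x ^ 3 + u ^ 3 * x ^ 3 + x ^ 2 * u ^ 3 + u ^ 6 * x ^ 2"
    unfolding s_def xu(5) by (simp add: cost_def xu(3,4) power_divide bal flip: power_mult)
  have R: "R = x ^ 3 * u ^ 3 + x ^ 2 * u ^ 6"
    unfolding R_def xu(6) by (simp add: xu(3,4) power_divide flip: power_mult)
  show "cost N 1 (N / \<epsilon>) (1 / \<epsilon>) s \<le> 2 * (real N + real N powr (2/3) / \<epsilon>)"
    unfolding s_def xu(5,6) by (simp add: cost_def xu(3,4) bal)
  have "x ^ 3 \<le> x ^ 3 * u ^ 3" "x ^ 2 * u ^ 3 \<le> x ^ 2 * u ^ 6"
    using xu(1,2) mult_left_mono[of 1 "u ^ 3" "x ^ 3"] by (simp_all add: power_increasing)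
  moreover have "0 \<le> x ^ 3" "0 \<le> x ^ 2 * u ^ 3" "0 \<le> x ^ 2 * u ^ 6" "0 \<le> x ^ 3 * u ^ 3"
    using xu(1,2) by simp_all
  ultimately show "cost N (1 / \<epsilon>) (N / \<epsilon>) (1 / \<epsilon> ^ 2) s \<le> 3 * R"
    and "R \<le> cost N (1 / \<epsilon>) (N / \<epsilon>) (1 / \<epsilon> ^ 2) s"
    unfolding E R by (auto simp: mult.commute[of "u ^ 3"] mult.commute[of "u ^ 6"])
qed

section \<open>Calculus of the soft Landau classes\<close>

lemma soft_bigo_bigo_trans:
  assumes "f \<in> soft_bigo F g" "g \<in> O[F](h)"
  shows "f \<in> soft_bigo F h"
proof -
  obtain k where "f \<in> O[F](\<lambda>x. g x * ln (1 / fst x) ^ k)"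
    using assms(1) by (auto simp: soft_bigo_def)
  also have "(\<lambda>x. g x * ln (1 / fst x) ^ k) \<in> O[F](\<lambda>x. h x * ln (1 / fst x) ^ k)"
    by (intro landau_o.big.mult_right assms(2))
  finally show ?thesis
    by (auto simp: soft_bigo_def)
qed

lemma bigo_soft_bigo_trans:
  assumes "f \<in> O[F](g)" "g \<in> soft_bigo F h"
  shows "f \<in> soft_bigo F h"
  using assms unfolding soft_bigo_def by (auto intro: landau_o.big_trans)

lemma soft_bigtheta_bigtheta_trans:
  assumes "f \<in> soft_bigtheta F g" "g \<in> \<Theta>[F](h)"
  shows "f \<in> soft_bigtheta F h"
proof -
  have "h \<in> O[F](g)"
    using assms(2) by (simp add: bigtheta_sym bigthetaD1)
  then show ?thesis
    using assms soft_bigo_bigo_trans bigo_soft_bigo_trans bigthetaD1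
    unfolding soft_bigtheta_def by blast
qed

text \<open>The logarithmic factor depends only on the first component, so a substitution preserving
  that component keeps the same exponent.\<close>

lemma soft_bigtheta_compose:
  assumes "f \<in> soft_bigtheta F g" "filterlim h F G" "\<And>y. fst (h y) = fst y"
  shows "(\<lambda>y. f (h y)) \<in> soft_bigtheta G (\<lambda>y. g (h y))"
  using assms(1) landau_o.big.compose[OF _ assms(2)]
  unfolding soft_bigtheta_def soft_bigo_def assms(3)[symmetric] by fast

section \<open>The joint limit and substitution of a choice of \<tau>\<close>

lemma eventually_eps_N: "\<forall>\<^sub>F (\<epsilon>, N) in eps_N. 0 < \<epsilon> \<and> \<epsilon> < 1 \<and> 1 \<le> N"
proof -
  have "\<forall>\<^sub>F \<epsilon> :: real in at_right 0. 0 < \<epsilon> \<and> \<epsilon> < 1"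
    using eventually_at_right_real[of 0 1] by simp
  then show ?thesis
    unfolding eps_N_def eventually_prod_filter
    using eventually_ge_at_top[of "1 :: nat"] by fastforce
qed

text \<open>The principal filter only demands that \<tau> be positive eventually, so arbitrary
  choices, with no growth condition, are covered.\<close>

lemma filterlim_tau_choice:
  assumes "tau_choice \<tau>"
  shows "filterlim (\<lambda>(\<epsilon>, N). (\<epsilon>, N, \<tau> \<epsilon> N)) eps_N_tau eps_N"
proof -
  have "\<forall>\<^sub>F y in eps_N. \<tau> (fst y) (snd y) \<in> {1..}"
    using eventually_eps_N assms by (auto elim!: eventually_mono simp: tau_choice_def)
  then have "filterlim (\<lambda>y. (fst y, snd y, \<tau> (fst y) (snd y))) eps_N_tau eps_N"
    unfolding eps_N_tau_def
    by (intro filterlim_Pair filterlim_principal[THEN iffD2])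
      (auto simp: eps_N_def filterlim_def filtermap_fst_prod_filter filtermap_snd_prod_filter)
  then show ?thesis
    by (simp add: case_prod_beta')
qed

text \<open>Pulls the assumed bound back along the graph of \<tau>; this is where its uniformity in
  \<tau> enters.\<close>

lemma rate_at_soft_bigtheta:
  assumes "(\<lambda>(\<epsilon>, N, \<tau>). C \<epsilon> N \<tau>) \<in> soft_bigtheta eps_N_tau (\<lambda>(\<epsilon>, N, \<tau>). G \<epsilon> N (real \<tau>))"
    and "tau_choice \<tau>"
  shows "rate_at C \<tau> \<in> soft_bigtheta eps_N (\<lambda>(\<epsilon>, N). G \<epsilon> N (real (\<tau> \<epsilon> N)))"
  using soft_bigtheta_compose[OF assms(1) filterlim_tau_choice[OF assms(2)]]
  by (simp add: rate_at_def case_prod_beta')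

lemma bigo_eps_NI:
  fixes f g :: "real \<Rightarrow> nat \<Rightarrow> real"
  assumes "\<And>\<epsilon> N. 0 < \<epsilon> \<Longrightarrow> \<epsilon> < 1 \<Longrightarrow> 1 \<le> N \<Longrightarrow> \<bar>f \<epsilon> N\<bar> \<le> K * \<bar>g \<epsilon> N\<bar>"
  shows "(\<lambda>(\<epsilon>, N). f \<epsilon> N) \<in> O[eps_N](\<lambda>(\<epsilon>, N). g \<epsilon> N)"
  using eventually_eps_N assms
  by (intro bigoI[of _ K]) (auto elim!: eventually_mono)

section \<open>Rates along a choice of \<tau>\<close>

lemma cost_bigtheta_of_order:
  fixes p q :: "real \<Rightarrow> real"
  assumes \<tau>: "\<tau> \<in> tau_of_order (\<lambda>(\<epsilon>, N). s \<epsilon> N)"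
    and s: "\<And>\<epsilon> N. 0 < \<epsilon> \<Longrightarrow> \<epsilon> < 1 \<Longrightarrow> 1 \<le> N \<Longrightarrow> 1 \<le> s \<epsilon> N"
    and pq: "\<And>\<epsilon>. 0 < \<epsilon> \<Longrightarrow> 0 \<le> p \<epsilon>" "\<And>\<epsilon>. 0 < \<epsilon> \<Longrightarrow> 0 \<le> q \<epsilon>"
  shows "(\<lambda>(\<epsilon>, N). cost (real N) (p \<epsilon>) (real N / \<epsilon>) (q \<epsilon>) (real (\<tau> \<epsilon> N)))
    \<in> \<Theta>[eps_N](\<lambda>(\<epsilon>, N). cost (real N) (p \<epsilon>) (real N / \<epsilon>) (q \<epsilon>) (s \<epsilon> N))"
proof -
  have choice: "tau_choice \<tau>"
    and order: "(\<lambda>(\<epsilon>, N). real (\<tau> \<epsilon> N)) \<in> \<Theta>[eps_N](\<lambda>(\<epsilon>, N). s \<epsilon> N)"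
    using \<tau> by (simp_all add: tau_of_order_def)
  from bigthetaD1[OF order] obtain c where
    c: "\<forall>\<^sub>F (\<epsilon>, N) in eps_N. \<bar>real (\<tau> \<epsilon> N)\<bar> \<le> c * \<bar>s \<epsilon> N\<bar>"
    by (auto elim!: landau_o.bigE simp: case_prod_beta')
  have "(\<lambda>(\<epsilon>, N). s \<epsilon> N) \<in> O[eps_N](\<lambda>(\<epsilon>, N). real (\<tau> \<epsilon> N))"
    using order by (simp add: bigtheta_sym bigthetaD1)
  then obtain d where d: "\<forall>\<^sub>F (\<epsilon>, N) in eps_N. \<bar>s \<epsilon> N\<bar> \<le> d * \<bar>real (\<tau> \<epsilon> N)\<bar>"
    by (auto elim!: landau_o.bigE simp: case_prod_beta')
  \<comment> \<open>One factor for both comparisons of \<tau> with \<open>s\<close>; the maximum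
    with 1 supplies the hypothesis \<open>1 \<le> K\<close> of \<open>cost_rescale\<close>.\<close>
  define K where "K = max 1 (max c d)"
  have "\<forall>\<^sub>F (\<epsilon>, N) in eps_N.
      cost N (p \<epsilon>) (N / \<epsilon>) (q \<epsilon>) (\<tau> \<epsilon> N) \<le> K ^ 3 * cost N (p \<epsilon>) (N / \<epsilon>) (q \<epsilon>) (s \<epsilon> N) \<and>
      cost N (p \<epsilon>) (N / \<epsilon>) (q \<epsilon>) (s \<epsilon> N) \<le> K ^ 3 * cost N (p \<epsilon>) (N / \<epsilon>) (q \<epsilon>) (\<tau> \<epsilon> N) \<and>
      0 \<le> cost N (p \<epsilon>) (N / \<epsilon>) (q \<epsilon>) (\<tau> \<epsilon> N) \<and> 0 \<le> cost N (p \<epsilon>) (N / \<epsilon>) (q \<epsilon>) (s \<epsilon> N)"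
    using eventually_eps_N c d
  proof eventually_elim
    case (elim y)
    obtain \<epsilon> N where y: "y = (\<epsilon>, N)"
      by (cases y)
    have \<epsilon>N: "0 < \<epsilon>" "\<epsilon> < 1" "1 \<le> N"
      using elim(1) by (simp_all add: y)
    have t: "1 \<le> real (\<tau> \<epsilon> N)" and "1 \<le> s \<epsilon> N"
      using \<epsilon>N choice s by (simp_all add: tau_choice_def)
    have "real (\<tau> \<epsilon> N) \<le> c * s \<epsilon> N" "s \<epsilon> N \<le> d * real (\<tau> \<epsilon> N)"
      using elim(2,3) \<open>1 \<le> s \<epsilon> N\<close> by (simp_all add: y)
    moreover have "c * s \<epsilon> N \<le> K * s \<epsilon> N" "d * real (\<tau> \<epsilon> N) \<le> K * real (\<tau> \<epsilon> N)"
      using \<open>1 \<le> s \<epsilon> N\<close> by (auto simp: K_def intro!: mult_right_mono)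
    ultimately have *: "real (\<tau> \<epsilon> N) \<le> K * s \<epsilon> N" "s \<epsilon> N \<le> K * real (\<tau> \<epsilon> N)"
      by linarith+
    have "1 \<le> K"
      by (simp add: K_def)
    then show ?case
      using \<epsilon>N t \<open>1 \<le> s \<epsilon> N\<close> * pq[OF \<open>0 < \<epsilon>\<close>]
      by (auto simp: y intro!: cost_rescale cost_nonneg)
  qed
  then show ?thesis
    by (intro bigthetaI'[of "1 / K ^ 3" "K ^ 3"])
      (auto elim!: eventually_mono simp: K_def field_simps)
qed

text \<open>Three comparisons are chained: \<open>C\<close> with the cost at \<tau>, that cost with
  the cost at \<open>s\<close>, and the latter with \<open>R\<close>. Only the first is up to
  logarithms; the other two are plain \<Theta>.\<close>

lemma rate_at_of_order:
  fixes p q :: "real \<Rightarrow> real" and R s :: "real \<Rightarrow> nat \<Rightarrow> real"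
  assumes C: "(\<lambda>(\<epsilon>, N, \<tau>). C \<epsilon> N \<tau>) \<in> soft_bigtheta eps_N_tau
      (\<lambda>(\<epsilon>, N, \<tau>). cost (real N) (p \<epsilon>) (real N / \<epsilon>) (q \<epsilon>) (real \<tau>))"
    and \<tau>: "\<tau> \<in> tau_of_order (\<lambda>(\<epsilon>, N). s \<epsilon> N)"
    and pq: "\<And>\<epsilon>. 0 < \<epsilon> \<Longrightarrow> 0 \<le> p \<epsilon>" "\<And>\<epsilon>. 0 < \<epsilon> \<Longrightarrow> 0 \<le> q \<epsilon>"
    and s: "\<And>\<epsilon> N. 0 < \<epsilon> \<Longrightarrow> \<epsilon> < 1 \<Longrightarrow> 1 \<le> N \<Longrightarrow> 1 \<le> s \<epsilon> N"
    and R: "\<And>\<epsilon> N. 0 < \<epsilon> \<Longrightarrow> 0 \<le> R \<epsilon> N"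
    and upper: "\<And>\<epsilon> N. 0 < \<epsilon> \<Longrightarrow> \<epsilon> < 1 \<Longrightarrow> 1 \<le> N \<Longrightarrow>
      cost (real N) (p \<epsilon>) (real N / \<epsilon>) (q \<epsilon>) (s \<epsilon> N) \<le> K * R \<epsilon> N"
    and lower: "\<And>\<epsilon> N. 0 < \<epsilon> \<Longrightarrow> \<epsilon> < 1 \<Longrightarrow> 1 \<le> N \<Longrightarrow>
      R \<epsilon> N \<le> L * cost (real N) (p \<epsilon>) (real N / \<epsilon>) (q \<epsilon>) (s \<epsilon> N)"
  shows "rate_at C \<tau> \<in> soft_bigtheta eps_N (\<lambda>(\<epsilon>, N). R \<epsilon> N)"
proof -
  have nn: "0 \<le> cost (real N) (p \<epsilon>) (real N / \<epsilon>) (q \<epsilon>) (s \<epsilon> N)"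
    if "0 < \<epsilon>" "\<epsilon> < 1" "1 \<le> N" for \<epsilon> N
    using that pq[OF that(1)] s[OF that] by (intro cost_nonneg) auto
  have "(\<lambda>(\<epsilon>, N). cost (real N) (p \<epsilon>) (real N / \<epsilon>) (q \<epsilon>) (s \<epsilon> N))
      \<in> O[eps_N](\<lambda>(\<epsilon>, N). R \<epsilon> N)"
    using upper R nn by (intro bigo_eps_NI[of _ K]) simp
  moreover have "(\<lambda>(\<epsilon>, N). R \<epsilon> N)
      \<in> O[eps_N](\<lambda>(\<epsilon>, N). cost (real N) (p \<epsilon>) (real N / \<epsilon>) (q \<epsilon>) (s \<epsilon> N))"
    using lower R nn by (intro bigo_eps_NI[of _ L]) simp
  ultimately have "(\<lambda>(\<epsilon>, N). cost (real N) (p \<epsilon>) (real N / \<epsilon>) (q \<epsilon>) (s \<epsilon> N))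
      \<in> \<Theta>[eps_N](\<lambda>(\<epsilon>, N). R \<epsilon> N)"
    by (simp add: bigtheta_def bigomega_iff_bigo)
  with cost_bigtheta_of_order[OF \<tau> s pq]
  have "(\<lambda>(\<epsilon>, N). cost (real N) (p \<epsilon>) (real N / \<epsilon>) (q \<epsilon>) (real (\<tau> \<epsilon> N)))
      \<in> \<Theta>[eps_N](\<lambda>(\<epsilon>, N). R \<epsilon> N)"
    by (rule landau_theta.trans)
  moreover have "tau_choice \<tau>"
    using \<tau> by (simp add: tau_of_order_def)
  ultimately show ?thesis
    using rate_at_soft_bigtheta[OF C] soft_bigtheta_bigtheta_trans by blast
qed

text \<open>A pointwise bound valid for every real \<open>1 \<le> t\<close> holds in particular
  along any choice of \<tau>, which gives the optimality half of
  \<open>minimal_rate\<close>.\<close>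

lemma rate_at_lower_bound:
  fixes p q :: "real \<Rightarrow> real" and R :: "real \<Rightarrow> nat \<Rightarrow> real"
  assumes C: "(\<lambda>(\<epsilon>, N, \<tau>). C \<epsilon> N \<tau>) \<in> soft_bigtheta eps_N_tau
      (\<lambda>(\<epsilon>, N, \<tau>). cost (real N) (p \<epsilon>) (real N / \<epsilon>) (q \<epsilon>) (real \<tau>))"
    and \<tau>: "tau_choice \<tau>"
    and pq: "\<And>\<epsilon>. 0 < \<epsilon> \<Longrightarrow> 0 \<le> p \<epsilon>" "\<And>\<epsilon>. 0 < \<epsilon> \<Longrightarrow> 0 \<le> q \<epsilon>"
    and R: "\<And>\<epsilon> N. 0 < \<epsilon> \<Longrightarrow> 0 \<le> R \<epsilon> N"
    and lower: "\<And>\<epsilon> N t. 0 < \<epsilon> \<Longrightarrow> \<epsilon> < 1 \<Longrightarrow> 1 \<le> N \<Longrightarrow> 1 \<le> t \<Longrightarrow>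
      R \<epsilon> N \<le> L * cost (real N) (p \<epsilon>) (real N / \<epsilon>) (q \<epsilon>) t"
  shows "(\<lambda>(\<epsilon>, N). R \<epsilon> N) \<in> soft_bigo eps_N (rate_at C \<tau>)"
proof -
  have "(\<lambda>(\<epsilon>, N). R \<epsilon> N)
      \<in> O[eps_N](\<lambda>(\<epsilon>, N). cost (real N) (p \<epsilon>) (real N / \<epsilon>) (q \<epsilon>) (real (\<tau> \<epsilon> N)))"
  proof (rule bigo_eps_NI)
    fix \<epsilon> :: real and N :: nat
    assume \<epsilon>N: "0 < \<epsilon>" "\<epsilon> < 1" "1 \<le> N"
    have "1 \<le> real (\<tau> \<epsilon> N)"
      using \<tau> \<epsilon>N by (simp add: tau_choice_def)
    then show "\<bar>R \<epsilon> N\<bar>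
        \<le> L * \<bar>cost (real N) (p \<epsilon>) (real N / \<epsilon>) (q \<epsilon>) (real (\<tau> \<epsilon> N))\<bar>"
      using lower[OF \<epsilon>N] R[OF \<epsilon>N(1)] pq[OF \<epsilon>N(1)] \<epsilon>N(1) by (simp add: cost_nonneg)
  qed
  then show ?thesis
    using rate_at_soft_bigtheta[OF C \<tau>] bigo_soft_bigo_trans
    unfolding soft_bigtheta_def by blast
qed

text \<open>Rounding \<open>s\<close> up at most doubles it, because it is at least 1. This bound is
  assumed for all \<epsilon> > 0, not just small ones, as \<open>tau_choice\<close> asks for
  positivity everywhere.\<close>

lemma tau_of_order_nonempty:
  assumes s: "\<And>\<epsilon> N. 0 < \<epsilon> \<Longrightarrow> 1 \<le> N \<Longrightarrow> 1 \<le> s \<epsilon> N"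
  shows "tau_of_order (\<lambda>(\<epsilon>, N). s \<epsilon> N) \<noteq> {}"
proof -
  define \<tau> where "\<tau> \<epsilon> N = nat \<lceil>s \<epsilon> N\<rceil>" for \<epsilon> N
  have \<tau>: "s \<epsilon> N \<le> real (\<tau> \<epsilon> N)" "real (\<tau> \<epsilon> N) \<le> 2 * s \<epsilon> N"
    if "0 < \<epsilon>" "1 \<le> N" for \<epsilon> N
    using s[OF that] unfolding \<tau>_def by linarith+
  have "tau_choice \<tau>"
    unfolding tau_choice_def
  proof (intro allI impI)
    fix \<epsilon> :: real and N :: nat
    assume "0 < \<epsilon>" "1 \<le> N"
    then show "1 \<le> \<tau> \<epsilon> N"
      using s[of \<epsilon> N] \<tau>(1)[of \<epsilon> N] by linarith
  qed
  moreover have "(\<lambda>(\<epsilon>, N). real (\<tau> \<epsilon> N)) \<in> O[eps_N](\<lambda>(\<epsilon>, N). s \<epsilon> N)"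
    using \<tau> s by (intro bigo_eps_NI[of _ 2]) (smt (verit))
  moreover have "(\<lambda>(\<epsilon>, N). s \<epsilon> N) \<in> O[eps_N](\<lambda>(\<epsilon>, N). real (\<tau> \<epsilon> N))"
    using \<tau> s by (intro bigo_eps_NI[of _ 1]) (smt (verit))
  ultimately show ?thesis
    by (auto simp: tau_of_order_def bigtheta_def bigomega_iff_bigo)
qed

text \<open>Any member of the nonempty set \<open>T\<close> witnesses attainment of the
  rate.\<close>

lemma minimal_rateI:
  assumes "\<And>\<tau>. tau_choice \<tau> \<Longrightarrow> R \<in> soft_bigo eps_N (rate_at C \<tau>)"
    and "T \<noteq> {}" "T \<subseteq> Collect tau_choice"
    and "\<And>\<tau>. \<tau> \<in> T \<Longrightarrow> rate_at C \<tau> \<in> soft_bigtheta eps_N R"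
  shows "minimal_rate C R"
  using assms unfolding minimal_rate_def by blast

theorem corollary3p15:
  fixes E J :: "real \<Rightarrow> nat \<Rightarrow> nat \<Rightarrow> real"
  assumes "(\<lambda>(\<epsilon>, N, \<tau>). E \<epsilon> N \<tau>) \<in> soft_bigtheta eps_N_tau
      (\<lambda>(\<epsilon>, N, \<tau>). real N + real \<tau> ^ 3 / \<epsilon> + real N / (\<epsilon> * real \<tau>) + real \<tau> ^ 2 / \<epsilon> ^ 2)"
    and "(\<lambda>(\<epsilon>, N, \<tau>). J \<epsilon> N \<tau>) \<in> soft_bigtheta eps_N_tau
      (\<lambda>(\<epsilon>, N, \<tau>). real N + real \<tau> ^ 3 + real N / (\<epsilon> * real \<tau>) + real \<tau> ^ 2 / \<epsilon>)"
  defines "RE \<equiv> (\<lambda>(\<epsilon>, N). real N + 1 / \<epsilon> ^ 2 + real N powr (2/3) * \<epsilon> powr (-4/3))"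
    and "RJ \<equiv> (\<lambda>(\<epsilon>, N). real N + real N powr (2/3) / \<epsilon>)"
    and "TE \<equiv> tau_of_order (\<lambda>(\<epsilon>, N). max 1 (real N powr (1/3) * \<epsilon> powr (1/3)))"
    and "TJ \<equiv> tau_of_order (\<lambda>(\<epsilon>, N). real N powr (1/3))"
  shows "(minimal_rate E RE \<and> TE \<noteq> {} \<and>
      (\<forall>\<tau>\<in>TE. rate_at E \<tau> \<in> soft_bigtheta eps_N RE \<and>
        rate_at J \<tau> \<in> soft_bigtheta eps_N
          (\<lambda>(\<epsilon>, N). min (real N / \<epsilon>) (real N + real N powr (2/3) * \<epsilon> powr (-4/3))))) \<and>
    (minimal_rate J RJ \<and> TJ \<noteq> {} \<and>
      (\<forall>\<tau>\<in>TJ. rate_at J \<tau> \<in> soft_bigtheta eps_N RJ \<and>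
        rate_at E \<tau> \<in> soft_bigtheta eps_N
          (\<lambda>(\<epsilon>, N). real N / \<epsilon> + real N powr (2/3) / \<epsilon> ^ 2)))"
proof -
  have E: "(\<lambda>(\<epsilon>, N, \<tau>). E \<epsilon> N \<tau>) \<in> soft_bigtheta eps_N_tau
      (\<lambda>(\<epsilon>, N, \<tau>). cost (real N) (1 / \<epsilon>) (real N / \<epsilon>) (1 / \<epsilon> ^ 2) (real \<tau>))"
    using assms(1) by (simp add: cost_def)
  have J: "(\<lambda>(\<epsilon>, N, \<tau>). J \<epsilon> N \<tau>) \<in> soft_bigtheta eps_N_tau
      (\<lambda>(\<epsilon>, N, \<tau>). cost (real N) 1 (real N / \<epsilon>) (1 / \<epsilon>) (real \<tau>))"
    using assms(2) by (simp add: cost_def)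
  have x: "1 \<le> real N powr (1/3)" if "1 \<le> N" for N :: nat
    using that by (simp add: ge_one_powr_ge_zero)
  have TE: "TE \<noteq> {}" "TE \<subseteq> Collect tau_choice"
    unfolding TE_def by (rule tau_of_order_nonempty) (auto simp: tau_of_order_def)
  have TJ: "TJ \<noteq> {}" "TJ \<subseteq> Collect tau_choice"
    unfolding TJ_def by (rule tau_of_order_nonempty[OF x]) (auto simp: tau_of_order_def)
  \<comment> \<open>The constant 4 comes from evaluating the cost at the cut-off balance point, and
    2 from the lower bound valid for all t \<ge> 1.\<close>
  have TE_E: "rate_at E \<tau> \<in> soft_bigtheta eps_N RE" if "\<tau> \<in> TE" for \<tau>
    unfolding RE_def
    by (rule rate_at_of_order[OF E that[unfolded TE_def], where K = 4 and L = 2])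
      (use cost_at_eval_choice(1) eval_rate_le_cost in auto)
  \<comment> \<open>The target is not a lower bound for \<open>J\<close> over all choices, so both
    directions come from the evaluation at this particular \<open>s\<close>.\<close>
  have TE_J: "rate_at J \<tau> \<in> soft_bigtheta eps_N
      (\<lambda>(\<epsilon>, N). min (real N / \<epsilon>) (real N + real N powr (2/3) * \<epsilon> powr (-4/3)))"
    if "\<tau> \<in> TE" for \<tau>
    by (rule rate_at_of_order[OF J that[unfolded TE_def], where K = 4 and L = 1])
      (use cost_at_eval_choice(2,3) in auto)
  have TJ_J: "rate_at J \<tau> \<in> soft_bigtheta eps_N RJ" if "\<tau> \<in> TJ" for \<tau>
    unfolding RJ_def
    by (rule rate_at_of_order[OF J that[unfolded TJ_def], where K = 2 and L = 1])
      (use x cost_at_jacobian_choice(1) jacobian_rate_le_cost in auto)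
  have TJ_E: "rate_at E \<tau> \<in> soft_bigtheta eps_N
      (\<lambda>(\<epsilon>, N). real N / \<epsilon> + real N powr (2/3) / \<epsilon> ^ 2)"
    if "\<tau> \<in> TJ" for \<tau>
    by (rule rate_at_of_order[OF E that[unfolded TJ_def], where K = 3 and L = 1])
      (use x cost_at_jacobian_choice(2,3) in auto)
  have "minimal_rate E RE"
  proof (rule minimal_rateI[OF _ TE TE_E])
    show "RE \<in> soft_bigo eps_N (rate_at E \<tau>)" if "tau_choice \<tau>" for \<tau>
      unfolding RE_def
      by (rule rate_at_lower_bound[OF E that, where L = 2]) (use eval_rate_le_cost in auto)
  qed
  moreover have "minimal_rate J RJ"
  proof (rule minimal_rateI[OF _ TJ TJ_J])
    show "RJ \<in> soft_bigo eps_N (rate_at J \<tau>)" if "tau_choice \<tau>" for \<tau>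
      unfolding RJ_def
      by (rule rate_at_lower_bound[OF J that, where L = 1]) (use jacobian_rate_le_cost in auto)
  qed
  ultimately show ?thesis
    using TE TJ TE_E TE_J TJ_J TJ_E by blast
qed

end
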